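(* Let $M=M_D+M_{\mathrm{off}}$ be a complex matrix of order $n$, where $M$ is partitioned as a $k\times k$ block matrix with square diagonal blocks, $M_D$ is its block diagonal part and $M_{\mathrm{off}}$ its block off-diagonal part. Let $M_D$ be non-singular and $\rho\equiv\rho(M_D^{-1}M_{\mathrm{off}})<1$. Define $$\delta_m\equiv\ln(\det(M_D))+\sum_{p=1}^m\frac{(-1)^{p-1}}{p}\,\mathrm{trace}\big((M_D^{-1}M_{\mathrm{off}})^p\big),\qquad \Delta_m\equiv e^{\delta_m},\qquad m\geq 1.$$ Then $$|\ln(\det(M))-\delta_m|\leq c\rho^m,\qquad \frac{|\det(M)-\Delta_m|}{|\Delta_m|}\leq c\rho^m\,e^{c\rho^m},$$ where $c\equiv -n\ln(1-\rho)$. If also $c\rho^m<1$, then $$\frac{|\det(M)-\Delta_m|}{|\Delta_m|}\leq \frac{7}{4}\,c\,\rho^m.$$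
   Context: $\rho(A)=\max_j|\lambda_j(A)|$ is the spectral radius of a square matrix $A$ with eigenvalues $\lambda_j(A)$. Given a partition of $M$ as a $k\times k$ block matrix $(M_{ij})_{1\le i,j\le k}$ whose diagonal blocks $M_{jj}$ are square (not necessarily of the same dimension), $M_D$ is the block diagonal matrix with diagonal blocks $M_{11},\dots,M_{kk}$ and zero off-diagonal blocks, and $M_{\mathrm{off}}=M-M_D$ (so $M_{\mathrm{off}}$ has zero diagonal blocks). $\ln(x)$ and $e^x$ denote the natural logarithm and exponential function of a scalar $x$.
   Formalization: For complex M, ln(det(M)) is not the principal value (the first bound can then fail by 2πi) but the logarithm continued from the principal ln(det(M_D)) along det(M_D + t M_off), 0 ≤ t ≤ 1; for real M it is the principal value. *)

theory Defs
  imports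
    "Jordan_Normal_Form.Spectral_Radius"
    "Jordan_Normal_Form.Gauss_Jordan_Elimination"
    "HOL-Analysis.Complex_Transcendental"
begin

definition mat_trace :: "'a :: comm_monoid_add mat \<Rightarrow> 'a" where
  "mat_trace A = (\<Sum>i<dim_row A. A $$ (i, i))"

text \<open>A partition of a matrix of order \<open>n\<close> into \<open>k \<times> k\<close> blocks with square diagonal blocks is
  given by the list \<open>ds\<close> of the orders of its \<open>k = length ds\<close> diagonal blocks.\<close>

definition block_partition :: "nat \<Rightarrow> nat list \<Rightarrow> bool" where
  "block_partition n ds \<longleftrightarrow> (\<forall>d \<in> set ds. 0 < d) \<and> sum_list ds = n"

definition block :: "nat list \<Rightarrow> 'a mat \<Rightarrow> nat \<Rightarrow> nat \<Rightarrow> 'a mat" where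
  "block ds M i j = Matrix.mat (ds ! i) (ds ! j)
     (\<lambda>(r, s). M $$ (sum_list (take i ds) + r, sum_list (take j ds) + s))"

definition block_diag :: "nat list \<Rightarrow> 'a :: zero mat \<Rightarrow> 'a mat" where
  "block_diag ds M = diag_block_mat (map (\<lambda>j. block ds M j j) [0..<length ds])"

definition block_off :: "nat list \<Rightarrow> 'a :: {zero, minus} mat \<Rightarrow> 'a mat" where
  "block_off ds M = M - block_diag ds M"

lemma block_diag_carrier: "block_partition n ds \<Longrightarrow> block_diag ds M \<in> carrier_mat n n"
  by (auto simp: block_partition_def block_diag_def block_def dim_diag_block_mat o_def map_nth
      intro!: carrier_matI)

text \<open>\<open>mat_inverse\<close> returns the inverse as an option, so the following is meaningful only if
  \<open>block_diag ds M\<close> is invertible.\<close>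

definition block_iter :: "nat list \<Rightarrow> 'a :: field mat \<Rightarrow> 'a mat" where
  "block_iter ds M = the (mat_inverse (block_diag ds M)) * block_off ds M"

definition det_delta :: "nat list \<Rightarrow> complex mat \<Rightarrow> nat \<Rightarrow> complex" where
  "det_delta ds M m = ln (Determinant.det (block_diag ds M))
     + (\<Sum>p = 1..m. (-1) ^ (p - 1) / of_nat p * mat_trace (block_iter ds M ^\<^sub>m p))"

definition det_Delta :: "nat list \<Rightarrow> complex mat \<Rightarrow> nat \<Rightarrow> complex" where
  "det_Delta ds M m = exp (det_delta ds M m)"

text \<open>\<open>w\<close> is the logarithm of \<open>g 1\<close> obtained from the logarithm \<open>z\<close> of \<open>g 0\<close> by continuation
  along the path \<open>g\<close>.\<close>

definition log_along :: "(real \<Rightarrow> complex) \<Rightarrow> complex \<Rightarrow> complex \<Rightarrow> bool" where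
  "log_along g z w \<longleftrightarrow> (\<exists>L. continuous_on {0..1} L \<and> (\<forall>t \<in> {0..1}. exp (L t) = g t)
     \<and> L 0 = z \<and> L 1 = w)"

lemma log_along_exp: "log_along g z w \<Longrightarrow> exp w = g 1"
  by (auto simp: log_along_def)

lemma log_along_unique:
  assumes "log_along g z w" "log_along g z w'"
  shows "w = w'"
proof -
  obtain L where L: "continuous_on {0..1} L" "\<forall>t \<in> {0..1}. exp (L t) = g t" "L 0 = z" "L 1 = w"
    using assms(1) unfolding log_along_def by blast
  obtain K where K: "continuous_on {0..1} K" "\<forall>t \<in> {0..1}. exp (K t) = g t" "K 0 = z" "K 1 = w'"
    using assms(2) unfolding log_along_def by blast
  define h where "h t = (L t - K t) / (2 * pi * \<i>)" for t
  have h_Ints: "h t \<in> \<int>" if "t \<in> {0..1}" for t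
  proof -
    have "exp (L t) = exp (K t)" using that L K by simp
    then obtain k :: int where "L t = K t + of_int (2 * k) * pi * \<i>"
      unfolding exp_eq by auto
    then have "h t = of_int k" by (simp add: h_def)
    then show ?thesis by simp
  qed
  have cont: "continuous_on {0..1} h"
    unfolding h_def by (intro continuous_intros L K) auto
  have "h constant_on {0..1}"
  proof (rule continuous_discrete_range_constant[OF _ cont])
    show "connected {0..1::real}" by simp
    show "\<exists>e>0. \<forall>y. y \<in> {0..1} \<and> h y \<noteq> h x \<longrightarrow> e \<le> norm (h y - h x)" if x: "x \<in> {0..1}" for x
    proof (intro exI[of _ 1] conjI allI impI)
      fix y assume y: "y \<in> {0..1} \<and> h y \<noteq> h x"
      then have "h y - h x \<in> \<int>" using h_Ints x by auto
      then obtain k where "h y - h x = of_int k" by (auto elim: Ints_cases)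
      moreover have "k \<noteq> 0" using calculation y by auto
      ultimately show "1 \<le> norm (h y - h x)" by simp
    qed simp
  qed
  then have "h 1 = h 0" unfolding constant_on_def by force
  then show ?thesis using L K by (simp add: h_def)
qed

lemma log_along_Ln:
  assumes "continuous_on {0..1} g" "\<And>t. t \<in> {0..1} \<Longrightarrow> g t \<notin> \<real>\<^sub>\<le>\<^sub>0"
  shows "log_along g (ln (g 0)) (ln (g 1))"
  unfolding log_along_def
proof (intro exI conjI ballI)
  show "continuous_on {0..1} (\<lambda>t. ln (g t))"
    using assms by (intro continuous_intros) auto
  show "exp (ln (g t)) = g t" if "t \<in> {0..1}" for t
    using assms(2)[OF that] by (intro exp_Ln) auto
qed simp_all

text \<open>For complex matrices the principal value of \<open>ln (det M)\<close> may differ by a nonzero multiple of \<open>2\<pi>\<i>\<close> from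
  the one compatible with \<open>det_delta\<close>: already for \<open>2 \<times> 2\<close> matrices \<open>det M\<close> can lie just across the
  branch cut from \<open>det M\<^sub>D\<close>. Hence \<open>l\<close> is a value of \<open>ln (det M)\<close> if it arises from the principal
  value of \<open>ln (det M\<^sub>D)\<close> by continuation along the determinants of \<open>M\<^sub>D + t M\<^sub>o\<^sub>f\<^sub>f\<close>. It is unique by
  \<open>log_along_unique\<close>, and by \<open>log_along_Ln\<close> it is the principal value if these determinants avoid
  the branch cut.\<close>

definition is_ln_det :: "nat list \<Rightarrow> complex mat \<Rightarrow> complex \<Rightarrow> bool" where
  "is_ln_det ds M l \<longleftrightarrow>
     log_along (\<lambda>t. Determinant.det (block_diag ds M + of_real t \<cdot>\<^sub>m block_off ds M))
       (ln (Determinant.det (block_diag ds M))) l"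

end

theory Submission
  imports Defs
begin

text \<open>Let \<open>a\<^sub>1, \<dots>, a\<^sub>n\<close> be the eigenvalues of \<open>A = M\<^sub>D\<^sup>-\<^sup>1 M\<^sub>o\<^sub>f\<^sub>f\<close>, read off the diagonal of a Schur form.
  Then \<open>det (M\<^sub>D + t M\<^sub>o\<^sub>f\<^sub>f) = det M\<^sub>D \<cdot> \<Prod>(1 + t a\<^sub>i)\<close>, and since \<open>\<bar>t a\<^sub>i\<bar> < 1\<close> the continued logarithm
  is \<open>ln (det M\<^sub>D) + \<Sum>ln (1 + t a\<^sub>i)\<close>. As \<open>trace (A\<^sup>p) = \<Sum>a\<^sub>i\<^sup>p\<close>, the error at \<open>t = 1\<close> is the sum of the
  \<open>n\<close> tails of the logarithm series, each at most \<open>\<rho>\<^sup>m\<close> times the series of \<open>- ln (1 - \<rho>)\<close>.\<close>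

section \<open>Scalar estimates for the logarithm and the exponential\<close>

text \<open>The tail begins at the power \<open>m + 1\<close>. Its terms are compared one by one
  with \<open>r ^ m\<close> times the series of \<open>- ln (1 - r)\<close>, by lowering the
  denominator \<open>i + m + 1\<close> to \<open>i + 1\<close>.\<close>

lemma Ln_series_remainder:
  fixes z :: complex
  assumes "cmod z \<le> r" "r < 1"
  shows "cmod (ln (1 + z) - (\<Sum>p = 1..m. (-1) ^ (p - 1) / of_nat p * z ^ p)) \<le> - ln (1 - r) * r ^ m"
proof -
  define f where "f n = (-1) ^ Suc n / of_nat n * z ^ n" for n
  have r0: "0 \<le> r" using assms(1) norm_ge_zero order_trans by blast
  have "f sums ln (1 + z)"
    unfolding f_def using assms by (intro Ln_series) auto
  then have "(\<lambda>i. f (i + Suc m)) sums (ln (1 + z) - (\<Sum>i<Suc m. f i))"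
    by (rule sums_split_initial_segment)
  moreover have "(\<Sum>i<Suc m. f i) = (\<Sum>p = 1..m. (-1) ^ (p - 1) / of_nat p * z ^ p)"
  proof -
    have "{..<Suc m} = insert 0 {1..m}" by auto
    \<comment> \<open>The index 0 contributes nothing: \<open>f 0 = 0\<close>, because division by
      \<open>of_nat 0\<close> yields 0.\<close>
    then have "(\<Sum>i<Suc m. f i) = (\<Sum>p = 1..m. f p)" by (simp add: f_def)
    also have "\<dots> = (\<Sum>p = 1..m. (-1) ^ (p - 1) / of_nat p * z ^ p)"
    proof (rule sum.cong)
      fix p assume "p \<in> {1..m}"
      then obtain q where "p = Suc q" by (cases p) auto
      then show "f p = (-1) ^ (p - 1) / of_nat p * z ^ p" by (simp add: f_def)
    qed simp
    finally show ?thesis .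
  qed
  ultimately have tail:
    "(\<lambda>i. f (i + Suc m)) sums (ln (1 + z) - (\<Sum>p = 1..m. (-1) ^ (p - 1) / of_nat p * z ^ p))"
    by simp
  have "(\<lambda>n. - (r ^ n / real n)) sums ln (1 - r)"
    using ln_series'[of "- r"] assms r0 by simp
  then have "(\<lambda>n. r ^ n / real n) sums (- ln (1 - r))"
    using sums_minus by fastforce
  \<comment> \<open>The shift loses nothing, since the dropped term is
    \<open>1 / 0 = 0\<close>.\<close>
  then have "(\<lambda>i. r ^ (i + 1) / real (i + 1)) sums (- ln (1 - r))"
    using sums_split_initial_segment[of "\<lambda>n. r ^ n / real n" _ 1] by simp
  then have bound: "(\<lambda>i. r ^ (i + 1) / real (i + 1) * r ^ m) sums (- ln (1 - r) * r ^ m)"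
    by (rule sums_mult2)
  show ?thesis
  proof (rule norm_sums_le[OF tail bound])
    fix i
    have "cmod (f (i + Suc m)) = cmod z ^ (i + Suc m) / real (i + Suc m)"
      by (simp only: f_def norm_mult norm_divide norm_power norm_minus_cancel norm_one
          norm_of_nat power_one) simp
    also have "\<dots> \<le> r ^ (i + Suc m) / real (i + 1)"
      using assms(1) r0 by (intro frac_le power_mono) auto
    also have "\<dots> = r ^ (i + 1) / real (i + 1) * r ^ m" by (simp add: power_add)
    finally show "cmod (f (i + Suc m)) \<le> r ^ (i + 1) / real (i + 1) * r ^ m" .
  qed
qed

text \<open>Both sides are power series without constant term, and the coefficients are positive, so
  the terms compare one by one.\<close>

lemma norm_exp_minus_one_le:
  fixes z :: complex
  shows "cmod (exp z - 1) \<le> exp (cmod z) - 1"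
proof -
  have tail: "(\<lambda>n. x ^ Suc n /\<^sub>R fact (Suc n)) sums (exp x - 1)"
    for x :: "'a :: {real_normed_algebra_1, banach}"
    using sums_split_initial_segment[OF exp_converges[of x], of 1] by simp
  show ?thesis
    by (rule norm_sums_le[OF tail tail]) (simp add: norm_mult norm_power)
qed

text \<open>This is \<open>1 - x \<le> exp (- x)\<close> multiplied by \<open>exp x\<close>.\<close>

lemma exp_minus_one_le_mult_exp: "exp x - 1 \<le> x * exp x" for x :: real
proof -
  have "(1 - x) * exp x \<le> exp (- x) * exp x"
    using exp_ge_add_one_self[of "- x"] by (intro mult_right_mono) auto
  then show ?thesis by (simp add: algebra_simps flip: exp_add)
qed

text \<open>By convexity, \<open>exp\<close> lies below its chord on the unit interval. The slope of
  the chord is \<open>exp 1 - 1 < 1.72\<close>, which explains the constant 7/4.\<close>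

lemma exp_minus_one_le_seven_quarters:
  fixes x :: real
  assumes "0 \<le> x" "x \<le> 1"
  shows "exp x - 1 \<le> 7 / 4 * x"
proof -
  have "exp ((1 - x) *\<^sub>R 0 + x *\<^sub>R 1) \<le> (1 - x) * exp 0 + x * exp (1 :: real)"
    by (rule convex_onD[OF exp_convex]) (use assms in auto)
  then have "exp x - 1 \<le> (exp 1 - 1) * x" by (simp add: algebra_simps)
  also have "\<dots> \<le> 7 / 4 * x"
    using e_less_272 assms(1) by (intro mult_right_mono) auto
  finally show ?thesis .
qed

section \<open>Triangular matrices, similarity and the Schur form\<close>

lemma index_mult_mat_sum:
  assumes "A \<in> carrier_mat n k" "B \<in> carrier_mat k m" "i < n" "j < m"
  shows "(A * B) $$ (i, j) = (\<Sum>l<k. A $$ (i, l) * B $$ (l, j))"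
  using assms by (auto simp: scalar_prod_def lessThan_atLeast0 intro!: sum.cong)

lemma upper_triangular_mult:
  fixes A B :: "'a :: comm_ring_1 mat"
  assumes A: "A \<in> carrier_mat n n" "upper_triangular A"
    and B: "B \<in> carrier_mat n n" "upper_triangular B"
  shows "upper_triangular (A * B)"
    and "i < n \<Longrightarrow> (A * B) $$ (i, i) = A $$ (i, i) * B $$ (i, i)"
proof -
  show "upper_triangular (A * B)"
  proof
    fix i j assume ij: "j < i" "i < dim_row (A * B)"
    have "A $$ (i, l) * B $$ (l, j) = 0" if "l < n" for l
      using that ij A B by (cases "l < i") (auto simp: upper_triangularD)
    then show "(A * B) $$ (i, j) = 0"
      using ij A B by (subst index_mult_mat_sum[OF A(1) B(1)]) auto
  qed
  assume i: "i < n"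
  have "A $$ (i, l) * B $$ (l, i) = 0" if "l < n" "l \<noteq> i" for l
    using that i A B by (cases "l < i") (auto simp: upper_triangularD)
  then have "(\<Sum>l<n. A $$ (i, l) * B $$ (l, i)) = (\<Sum>l\<in>{i}. A $$ (i, l) * B $$ (l, i))"
    using i by (intro sum.mono_neutral_right) auto
  then show "(A * B) $$ (i, i) = A $$ (i, i) * B $$ (i, i)"
    using i by (subst index_mult_mat_sum[OF A(1) B(1)]) auto
qed

lemma upper_triangular_pow:
  fixes A :: "'a :: comm_ring_1 mat"
  assumes A: "A \<in> carrier_mat n n" "upper_triangular A"
  shows "upper_triangular (A ^\<^sub>m p) \<and> (\<forall>i<n. (A ^\<^sub>m p) $$ (i, i) = A $$ (i, i) ^ p)"
proof (induction p)
  case 0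
  then show ?case using A by auto
next
  case (Suc p)
  then show ?case
    using upper_triangular_mult[of "A ^\<^sub>m p" n A] A by (auto simp: mult.commute)
qed

lemma mat_trace_mult_comm:
  fixes A B :: "'a :: comm_ring_1 mat"
  assumes "A \<in> carrier_mat n m" "B \<in> carrier_mat m n"
  shows "mat_trace (A * B) = mat_trace (B * A)"
proof -
  have "mat_trace (A * B) = (\<Sum>i<n. \<Sum>j<m. A $$ (i, j) * B $$ (j, i))"
    using assms by (auto simp: mat_trace_def index_mult_mat_sum[OF assms] simp del: index_mult_mat(1))
  also have "\<dots> = (\<Sum>j<m. \<Sum>i<n. B $$ (j, i) * A $$ (i, j))"
    by (subst sum.swap) (simp add: mult.commute)
  also have "\<dots> = mat_trace (B * A)"
    using assms by (auto simp: mat_trace_def index_mult_mat_sum[OF assms(2,1)] simp del: index_mult_mat(1))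
  finally show ?thesis .
qed

lemma mat_trace_similar:
  fixes A B :: "'a :: comm_ring_1 mat"
  assumes "similar_mat_wit A B P Q"
  shows "mat_trace A = mat_trace B"
proof -
  define n where "n = dim_row A"
  note w = similar_mat_witD[OF n_def assms]
  have "mat_trace A = mat_trace (Q * (P * B))"
    using w mat_trace_mult_comm[of "P * B" n n Q] by auto
  also have "Q * (P * B) = Q * P * B" by (rule assoc_mult_mat[symmetric]) (use w in auto)
  also have "\<dots> = B" using w by auto
  finally show ?thesis .
qed

text \<open>The witnesses \<open>P\<close> and \<open>Q\<close> also conjugate the shifted matrices,
  because conjugation is linear and fixes the identity.\<close>

lemma det_one_plus_smult_similar:
  fixes A B :: "'a :: comm_ring_1 mat"
  assumes "A \<in> carrier_mat n n" "similar_mat_wit A B P Q"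
  shows "det (1\<^sub>m n + t \<cdot>\<^sub>m A) = det (1\<^sub>m n + t \<cdot>\<^sub>m B)"
proof (rule det_similar)
  note w = similar_mat_witD2[OF assms]
  have "P * (1\<^sub>m n + t \<cdot>\<^sub>m B) * Q = (P * 1\<^sub>m n + P * (t \<cdot>\<^sub>m B)) * Q"
    by (subst mult_add_distrib_mat) (use w in auto)
  also have "\<dots> = P * 1\<^sub>m n * Q + P * (t \<cdot>\<^sub>m B) * Q"
    by (rule add_mult_distrib_mat) (use w in auto)
  also have "P * (t \<cdot>\<^sub>m B) * Q = t \<cdot>\<^sub>m (P * B * Q)"
    using w by (simp add: mult_smult_distrib[of P n n B n] mult_smult_assoc_mat[of "P * B" n n Q n])
  also have "P * 1\<^sub>m n * Q = 1\<^sub>m n" using w by simp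
  finally have "similar_mat_wit (1\<^sub>m n + t \<cdot>\<^sub>m A) (1\<^sub>m n + t \<cdot>\<^sub>m B) P Q"
    using w by (intro similar_mat_witI[of P Q n]) auto
  then show "similar_mat (1\<^sub>m n + t \<cdot>\<^sub>m A) (1\<^sub>m n + t \<cdot>\<^sub>m B)"
    unfolding similar_mat_def by blast
qed

text \<open>The family \<open>a\<close> lists the eigenvalues with multiplicity, so a single choice
  serves the traces of all powers and the determinants for all \<open>t\<close>.\<close>

lemma complex_mat_eigenvalues:
  fixes A :: "complex mat"
  assumes A: "A \<in> carrier_mat n n"
  obtains a :: "nat \<Rightarrow> complex"
  where "\<And>i. i < n \<Longrightarrow> a i \<in> spectrum A"
    and "\<And>p. mat_trace (A ^\<^sub>m p) = (\<Sum>i<n. a i ^ p)"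
    and "\<And>t. det (1\<^sub>m n + t \<cdot>\<^sub>m A) = (\<Prod>i<n. 1 + t * a i)"
proof -
  obtain es where "char_poly A = (\<Prod>e\<leftarrow>es. [:- e, 1:])"
    using char_poly_factorized[OF A] by blast
  from schur_decomposition_exists[OF A this] obtain B P Q where
    B: "B \<in> carrier_mat n n" "upper_triangular B" and wit: "similar_mat_wit A B P Q"
    unfolding similar_mat_def by blast
  define a where "a i = B $$ (i, i)" for i
  show ?thesis
  proof
    fix i assume i: "i < n"
    have "char_poly A = char_poly B"
      using wit by (intro char_poly_similar) (auto simp: similar_mat_def)
    also have "\<dots> = (\<Prod>x\<leftarrow>diag_mat B. [:- x, 1:])"
      by (rule char_poly_upper_triangular[OF B])
    finally have "poly (char_poly A) x = 0 \<longleftrightarrow> x \<in> set (diag_mat B)" for x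
      by (simp add: poly_prod_list prod_list_zero_iff o_def image_iff)
    moreover have "a i \<in> set (diag_mat B)"
      using i B(1) by (auto simp: diag_mat_def a_def)
    ultimately show "a i \<in> spectrum A"
      by (simp add: spectrum_root_char_poly[OF A])
  next
    fix p
    have "mat_trace (A ^\<^sub>m p) = mat_trace (B ^\<^sub>m p)"
      by (rule mat_trace_similar[OF similar_mat_wit_pow[OF wit]])
    also have "\<dots> = (\<Sum>i<n. a i ^ p)"
      using upper_triangular_pow[OF B, of p] B by (auto simp: mat_trace_def a_def)
    finally show "mat_trace (A ^\<^sub>m p) = (\<Sum>i<n. a i ^ p)" .
  next
    fix t
    have "upper_triangular (1\<^sub>m n + t \<cdot>\<^sub>m B)"
      using B by (auto simp: upper_triangularD)
    then have "det (1\<^sub>m n + t \<cdot>\<^sub>m B) = prod_list (diag_mat (1\<^sub>m n + t \<cdot>\<^sub>m B))"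
      by (rule det_upper_triangular) (use B in auto)
    also have "\<dots> = (\<Prod>i<n. 1 + t * a i)"
      using B by (auto simp: prod_list_diag_prod a_def lessThan_atLeast0 intro!: prod.cong)
    finally show "det (1\<^sub>m n + t \<cdot>\<^sub>m A) = (\<Prod>i<n. 1 + t * a i)"
      by (simp add: det_one_plus_smult_similar[OF A wit])
  qed
qed

text \<open>\<open>mat_inverse\<close> returns \<open>None\<close> only for matrices that are not
  units of the matrix ring; this justifies \<open>the\<close> in \<open>block_iter\<close>.\<close>

lemma invertible_mat_mat_inverse:
  fixes A :: "'a :: field mat"
  assumes A: "A \<in> carrier_mat n n" and inv: "invertible_mat A"
  obtains B where "mat_inverse A = Some B" "B \<in> carrier_mat n n" "A * B = 1\<^sub>m n" "B * A = 1\<^sub>m n"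
proof (cases "mat_inverse A")
  case (Some B)
  then show ?thesis using mat_inverse(2)[OF A Some] that by blast
next
  case None
  obtain B where B: "A * B = 1\<^sub>m n" "B * A = 1\<^sub>m (dim_row B)"
    using inv A unfolding invertible_mat_def inverts_mat_def by auto
  \<comment> \<open>\<open>inverts_mat\<close> does not fix the shape of \<open>B\<close>; it is
    recovered from the column counts of the two identity products.\<close>
  have "dim_col B = n" using arg_cong[OF B(1), of dim_col] by simp
  moreover have "dim_row B = n" using arg_cong[OF B(2), of dim_col] A by simp
  ultimately have "A \<in> Units (ring_mat TYPE('a) n ())"
    using A B by (auto simp: Units_def ring_mat_simps intro!: bexI[of _ B])
  then show ?thesis using mat_inverse(1)[OF A None, where b = "()"] by blast
qed

section \<open>The continued logarithm of the determinant and its error bounds\<close>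

theorem theorem2p6:
  fixes n :: nat and ds :: "nat list" and M :: "complex mat" and \<rho> c :: real
  assumes "0 < n"
    and "M \<in> carrier_mat n n"
    and "block_partition n ds"
    and "invertible_mat (block_diag ds M)"
    and "\<rho> = spectral_radius (block_iter ds M)"
    and "\<rho> < 1"
    and "c = - real n * ln (1 - \<rho>)"
  shows "(\<exists>l. is_ln_det ds M l \<and> exp l = Determinant.det M \<and>
            (\<forall>m\<ge>1. cmod (l - det_delta ds M m) \<le> c * \<rho> ^ m))
    \<and> (\<forall>m\<ge>1. cmod (Determinant.det M - det_Delta ds M m) / cmod (det_Delta ds M m)
            \<le> c * \<rho> ^ m * exp (c * \<rho> ^ m))
    \<and> (\<forall>m\<ge>1. c * \<rho> ^ m < 1 \<longrightarrow>
            cmod (Determinant.det M - det_Delta ds M m) / cmod (det_Delta ds M m)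
            \<le> 7 / 4 * c * \<rho> ^ m)"
proof -
  define D where "D = block_diag ds M"
  define N where "N = block_off ds M"
  define A where "A = block_iter ds M"
  have D: "D \<in> carrier_mat n n"
    using block_diag_carrier[OF assms(3)] by (simp add: D_def)
  have N: "N \<in> carrier_mat n n" and DN: "D + N = M"
    using assms(2) D by (auto simp: N_def block_off_def D_def[symmetric])
  obtain E where E: "mat_inverse D = Some E" "E \<in> carrier_mat n n" "D * E = 1\<^sub>m n"
    using invertible_mat_mat_inverse[OF D] assms(4) by (metis D_def)
  have A_eq: "A = E * N" using E(1) by (simp add: A_def block_iter_def D_def N_def)
  then have A: "A \<in> carrier_mat n n" using E N by auto
  have DA: "D * A = N"
    using A_eq assoc_mult_mat[OF D E(2) N] E(3) N by simp
  have detD: "det D \<noteq> 0"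
    using det_mult[OF D E(2)] E(3) by auto
  obtain a where a: "\<And>i. i < n \<Longrightarrow> a i \<in> spectrum A"
    and tr: "\<And>p. mat_trace (A ^\<^sub>m p) = (\<Sum>i<n. a i ^ p)"
    and det_t: "\<And>t. det (1\<^sub>m n + t \<cdot>\<^sub>m A) = (\<Prod>i<n. 1 + t * a i)"
    using complex_mat_eigenvalues[OF A] by blast
  \<comment> \<open>Since \<open>0 < n\<close>, the spectrum is nonempty and the spectral radius is
    a genuine maximum.\<close>
  have a_le: "cmod (a i) \<le> \<rho>" if "i < n" for i
    using spectral_radius_mem_max(2)[OF A assms(1)] a[OF that] assms(5) by (auto simp: A_def)
  have \<rho>0: "0 \<le> \<rho>" using a_le[OF assms(1)] norm_ge_zero order_trans by blast

  have det_path: "det (D + t \<cdot>\<^sub>m N) = det D * (\<Prod>i<n. 1 + t * a i)" for t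
  proof -
    have "D * (1\<^sub>m n + t \<cdot>\<^sub>m A) = D + t \<cdot>\<^sub>m N"
      using D A DA by (simp add: mult_add_distrib_mat[of D n n _ n] mult_smult_distrib[of D n n A n])
    then show ?thesis using det_mult[OF D, of "1\<^sub>m n + t \<cdot>\<^sub>m A"] A det_t by simp
  qed

  \<comment> \<open>A sum of principal logarithms is taken, not the logarithm of the product: each
    factor stays off the branch cut, even where the determinant itself crosses it.\<close>
  define L where "L t = ln (det D) + (\<Sum>i<n. ln (1 + of_real t * a i))" for t :: real
  \<comment> \<open>A factor on the cut would need \<open>t * a i\<close> of real part at most -1,
    hence of modulus at least 1.\<close>
  have nonpos: "1 + of_real t * a i \<notin> \<real>\<^sub>\<le>\<^sub>0" if "i < n" "t \<in> {0..1}" for i and t :: real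
  proof
    assume "1 + of_real t * a i \<in> \<real>\<^sub>\<le>\<^sub>0"
    then have "Re (1 + of_real t * a i) \<le> 0" by (simp add: complex_nonpos_Reals_iff)
    then have "1 \<le> cmod (of_real t * a i)"
      using complex_Re_le_cmod[of "- (of_real t * a i)"] by simp
    also have "\<dots> \<le> 1 * \<rho>"
      unfolding norm_mult using that a_le[OF that(1)] by (intro mult_mono) auto
    finally show False using assms(6) by simp
  qed
  have L_exp: "exp (L t) = det (D + of_real t \<cdot>\<^sub>m N)" if "t \<in> {0..1}" for t :: real
  proof -
    have "exp (ln (1 + of_real t * a i)) = 1 + of_real t * a i" if "i < n" for i
      using nonpos[OF that \<open>t \<in> {0..1}\<close>] by (intro exp_Ln) auto
    then show ?thesis
      using detD by (simp add: L_def exp_add exp_sum det_path)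
  qed
  have "continuous_on {0..1} L"
    unfolding L_def using nonpos by (intro continuous_intros) auto
  moreover have "L 0 = ln (det D)" by (simp add: L_def)
  ultimately have "is_ln_det ds M (L 1)"
    unfolding is_ln_det_def log_along_def D_def[symmetric] N_def[symmetric] using L_exp by blast
  moreover have exp_L: "exp (L 1) = det M"
  proof -
    have "1 \<cdot>\<^sub>m N = N" by (rule eq_matI) auto
    then show ?thesis using L_exp[of 1] DN by simp
  qed
  moreover have error: "cmod (L 1 - det_delta ds M m) \<le> c * \<rho> ^ m" for m
  proof -
    let ?s = "\<lambda>z. \<Sum>p = 1..m. (-1) ^ (p - 1) / of_nat p * z ^ p"
    \<comment> \<open>Exchanging the sums turns the traces into one truncated logarithm series per
      eigenvalue.\<close>
    have "det_delta ds M m = ln (det D) + (\<Sum>i<n. ?s (a i))"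
      unfolding det_delta_def D_def[symmetric] A_def[symmetric] tr sum_distrib_left
      by (subst sum.swap) simp
    then have "cmod (L 1 - det_delta ds M m) = cmod (\<Sum>i<n. ln (1 + a i) - ?s (a i))"
      by (simp add: L_def sum_subtractf)
    also have "\<dots> \<le> (\<Sum>i<n. - ln (1 - \<rho>) * \<rho> ^ m)"
      using Ln_series_remainder[OF a_le assms(6)] by (intro sum_norm_le) auto
    also have "\<dots> = c * \<rho> ^ m" by (simp add: assms(7))
    finally show ?thesis .
  qed
  \<comment> \<open>The quotient of \<open>det M\<close> by \<open>det_Delta ds M m\<close> is the
    exponential of the logarithmic error. Both relative estimates follow from this one bound, by
    different upper bounds for \<open>exp x - 1\<close> at
    \<open>x = c * \<rho> ^ m\<close>.\<close>
  moreover have rel: "cmod (det M - det_Delta ds M m) / cmod (det_Delta ds M m)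
      \<le> exp (c * \<rho> ^ m) - 1" for m
  proof -
    have "cmod (det M - det_Delta ds M m) / cmod (det_Delta ds M m)
        = cmod (exp (L 1 - det_delta ds M m) - 1)"
      unfolding det_Delta_def exp_diff exp_L norm_divide[symmetric]
      by (simp add: diff_divide_distrib del: norm_divide)
    also have "\<dots> \<le> exp (cmod (L 1 - det_delta ds M m)) - 1" by (rule norm_exp_minus_one_le)
    also have "\<dots> \<le> exp (c * \<rho> ^ m) - 1" using error by simp
    finally show ?thesis .
  qed
  \<comment> \<open>Nonnegativity is immediate from \<open>error\<close>, as the quantity dominates
    a norm; it places \<open>c * \<rho> ^ m\<close> in the unit interval for the chord
    bound.\<close>
  moreover have "0 \<le> c * \<rho> ^ m" for m using error norm_ge_zero order_trans by blast
  then have "c * \<rho> ^ m < 1 \<Longrightarrow> exp (c * \<rho> ^ m) - 1 \<le> 7 / 4 * c * \<rho> ^ m" for m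
    using exp_minus_one_le_seven_quarters[of "c * \<rho> ^ m"] by (simp add: mult.assoc)
  ultimately show ?thesis
    using exp_minus_one_le_mult_exp order_trans by blast
qed

end
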